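(* There exists an analytic univalent function $f$ on $\mathbb{D}=\{z\in\mathbb{C}:|z|<1\}$ with $f(0)=0$, $f'(0)=1$ such that the interior of $U_f=\{c\in\mathbb{C}: K_c[f]\text{ is univalent on }\mathbb{D}\}$ has at least two connected components.
   Context: Let $\operatorname{Log}(f(z)/z)$ denote the branch of $\log(f(z)/z)$ on $\mathbb{D}$ vanishing at $z=0$, and for $c\in\mathbb{C}$ set $K_c[f](z)=z\exp\big(c\operatorname{Log}(f(z)/z)\big)$. *)

theory Defs
  imports "HOL-Complex_Analysis.Complex_Analysis"
begin

abbreviation unit_disc :: "complex set" where
  "unit_disc \<equiv> ball 0 1"

definition quot_z :: "(complex \<Rightarrow> complex) \<Rightarrow> complex \<Rightarrow> complex" where
  "quot_z f z = (if z = 0 then deriv f 0 else f z / z)"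

definition Log_quot :: "(complex \<Rightarrow> complex) \<Rightarrow> complex \<Rightarrow> complex" where
  "Log_quot f = (THE g. g holomorphic_on unit_disc \<and> g 0 = 0 \<and>
       (\<forall>z\<in>unit_disc. exp (g z) = quot_z f z) \<and> (\<forall>z. z \<notin> unit_disc \<longrightarrow> g z = 0))"

definition K_op :: "complex \<Rightarrow> (complex \<Rightarrow> complex) \<Rightarrow> complex \<Rightarrow> complex" where
  "K_op c f z = z * exp (c * Log_quot f z)"

definition U_set :: "(complex \<Rightarrow> complex) \<Rightarrow> complex set" where
  "U_set f = {c. inj_on (K_op c f) unit_disc}"

end

theory Submission
  imports Defs
begin

text \<open>
  Take f(z) = z exp(G(z)) with z G'(z) = q(z) - 1 and q(z) = (1 - z)^(i eps), eps small.
  Along the real radius towards 1, q runs through the whole unit circle infinitely often, and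
  z K_c'(z) / K_c(z) = 1 + c (q(z) - 1) vanishes somewhere as soon as |1 - 1/c| = 1. So no c on
  the line Re c = 1/2 belongs to U_f, and it remains to show that 0 and 1 are interior points.

  In the coordinate w = log z, univalence of K_c amounts to w + c G(exp w) being injective on the
  left half-plane. Near c = 0 this holds because w |-> G(exp w) is Lipschitz there. Near c = 1 it
  holds because w + G(exp w) expands distances by at least a fixed factor: its derivative q
  rotates so slowly that a difference quotient is close to 1 away from z = 1, and close to
  a single value of q, of modulus about 1, near z = 1.
\<close>

section \<open>Elementary bounds for the exponential and the principal logarithm\<close>

lemma abs_sin_ge_half:
  fixes x :: real
  assumes "\<bar>x\<bar> \<le> pi / 2"
  shows "\<bar>x\<bar> / 2 \<le> \<bar>sin x\<bar>"
proof -
  have "\<bar>x\<bar> ^ 2 \<le> 3"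
  proof -
    have "pi \<le> 34 / 10" using pi_approx(2) by simp
    then have "\<bar>x\<bar> \<le> 17/10" using assms by linarith
    then have "\<bar>x\<bar> ^ 2 \<le> (17/10) ^ 2" by (intro power_mono) auto
    also have "\<dots> \<le> (3::real)" by (simp add: power2_eq_square)
    finally show ?thesis .
  qed
  then have "\<bar>x\<bar> ^ 2 * \<bar>x\<bar> \<le> 3 * \<bar>x\<bar>" by (intro mult_right_mono) auto
  then have "\<bar>x\<bar> ^ 3 / 6 \<le> \<bar>x\<bar> / 2" by (simp add: power3_eq_cube power2_eq_square)
  \<comment> \<open>The Taylor remainder is at most half of the absolute value of \<open>x\<close>,
    because the square of \<open>x\<close> is at most 3.\<close>
  moreover have "\<bar>sin x - x\<bar> \<le> \<bar>x\<bar> ^ 3 / 6"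
    using Maclaurin_sin_bound[of x 3] by (simp add: sin_coeff_def eval_nat_numeral)
  ultimately show ?thesis by linarith
qed

text \<open>With u = a + ib, the squared modulus of exp u - 1 is (exp a - 1)^2 + 4 exp a sin(b/2)^2,
  and a >= 0 bounds both summands below.\<close>

lemma norm_exp_minus_one_ge:
  fixes u :: complex
  assumes "0 \<le> Re u" "\<bar>Im u\<bar> \<le> pi"
  shows "norm u \<le> 2 * norm (exp u - 1)"
proof -
  define a b where "a = Re u" and "b = Im u"
  have ea: "1 \<le> exp a" "a \<le> exp a - 1"
    using assms(1) exp_ge_add_one_self[of a] unfolding a_def by linarith+
  have sb: "(b / 4)\<^sup>2 \<le> (sin (b / 2))\<^sup>2"
    using abs_sin_ge_half[of "b / 2"] assms by (auto simp: b_def abs_le_square_iff[symmetric])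
  have "(norm (exp u - 1))\<^sup>2 = (exp a * cos b - 1)\<^sup>2 + (exp a * sin b)\<^sup>2"
    by (simp add: cmod_power2 Re_exp Im_exp a_def b_def)
  also have "\<dots> = (exp a)\<^sup>2 * ((sin b)\<^sup>2 + (cos b)\<^sup>2) - 2 * exp a * cos b + 1"
    by algebra
  also have "\<dots> = (exp a)\<^sup>2 - 2 * exp a * cos b + 1" by simp
  also have "\<dots> = (exp a - 1)\<^sup>2 + 4 * exp a * (sin (b / 2))\<^sup>2"
  proof -
    have "cos b = 1 - 2 * (sin (b / 2))\<^sup>2" using cos_double_sin[of "b / 2"] by simp
    then show ?thesis by algebra
  qed
  also have "\<dots> \<ge> a\<^sup>2 + 4 * 1 * (b / 4)\<^sup>2"
    using ea sb assms(1) by (intro add_mono[OF power_mono mult_mono]) (auto simp: a_def)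
  finally have "a\<^sup>2 + b\<^sup>2 / 4 \<le> (norm (exp u - 1))\<^sup>2" by (simp add: power2_eq_square)
  moreover have "(norm u)\<^sup>2 = a\<^sup>2 + b\<^sup>2" by (simp add: cmod_power2 a_def b_def)
  moreover have "(2 * norm (exp u - 1))\<^sup>2 = 4 * (norm (exp u - 1))\<^sup>2" by (simp add: power_mult_distrib)
  ultimately have "(norm u)\<^sup>2 \<le> (2 * norm (exp u - 1))\<^sup>2"
    using zero_le_power2[of a] by linarith
  then show ?thesis by (rule power2_le_imp_le) auto
qed

text \<open>Apply the previous bound to u = \<open>Ln a - Ln b\<close>: its real part is nonnegative
  since \<open>b\<close> is the smaller point, and both arguments are below pi/2 in modulus. The
  weight \<open>norm b\<close> offsets the blow-up of the logarithm's derivative at 0.\<close>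

lemma norm_Ln_diff_le:
  fixes a b :: complex
  assumes "0 < Re a" "0 < Re b" "norm b \<le> norm a"
  shows "norm b * norm (Ln a - Ln b) \<le> 2 * norm (a - b)"
proof -
  have nz: "a \<noteq> 0" "b \<noteq> 0" using assms by auto
  have "norm (Ln a - Ln b) \<le> 2 * norm (exp (Ln a - Ln b) - 1)"
    using Re_Ln_pos_lt_imp[OF assms(1)] Re_Ln_pos_lt_imp[OF assms(2)] assms nz
    by (intro norm_exp_minus_one_ge) auto
  also have "exp (Ln a - Ln b) - 1 = (a - b) / b"
    using nz by (simp add: exp_diff field_simps)
  finally show ?thesis using nz by (simp add: norm_divide field_simps)
qed

text \<open>Comparison with \<open>Ln 1\<close>; whichever of \<open>a\<close> and 1 has the smaller
  modulus supplies the weight. The bound \<open>norm a \<le> 2\<close> covers every a = 1 - z with z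
  in the disc.\<close>

lemma norm_Ln_le:
  fixes a :: complex
  assumes "0 < Re a" "norm a \<le> 2"
  shows "norm a * norm (Ln a) \<le> 4 * norm (1 - a)"
proof (cases "norm a \<le> 1")
  case True
  have "norm a * norm (Ln 1 - Ln a) \<le> 2 * norm (1 - a)"
    by (rule norm_Ln_diff_le) (use assms True in auto)
  then show ?thesis using norm_ge_zero[of "1 - a"] by (simp del: norm_ge_zero)
next
  case False
  have "norm (1::complex) * norm (Ln a - Ln 1) \<le> 2 * norm (a - 1)"
    by (rule norm_Ln_diff_le) (use assms False in auto)
  then have "norm (Ln a) \<le> 2 * norm (1 - a)" by (simp add: norm_minus_commute)
  then have "norm a * norm (Ln a) \<le> 2 * (2 * norm (1 - a))"
    using assms by (intro mult_mono) auto
  then show ?thesis by simp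
qed

lemma norm_exp_diff_le:
  fixes x y :: complex
  assumes "Re x \<le> B" "Re y \<le> B"
  shows "norm (exp x - exp y) \<le> exp B * norm (x - y)"
proof (rule field_differentiable_bound[where S = "{z. Re z \<le> B}" and f' = exp])
  show "convex {z. Re z \<le> B}" by (rule convex_halfspace_Re_le)
qed (use assms in \<open>auto intro!: derivative_eq_intros\<close>)

section \<open>The power (1 - z)^(i eps) and estimates for its primitive G\<close>

definition spiral_power :: "real \<Rightarrow> complex \<Rightarrow> complex" where
  "spiral_power \<epsilon> z = exp (\<i> * of_real \<epsilon> * Ln (1 - z))"

lemma Re_one_minus_pos: "z \<in> unit_disc \<Longrightarrow> 0 < Re (1 - z)"
  using complex_Re_le_cmod[of z] by auto

lemma spiral_power_0 [simp]: "spiral_power \<epsilon> 0 = 1"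
  by (simp add: spiral_power_def)

lemma has_field_derivative_spiral_power:
  assumes "z \<in> unit_disc"
  shows "(spiral_power \<epsilon> has_field_derivative - (\<i> * of_real \<epsilon> * spiral_power \<epsilon> z / (1 - z))) (at z)"
  unfolding spiral_power_def
  using Re_one_minus_pos[OF assms]
  by (auto intro!: derivative_eq_intros simp: complex_nonpos_Reals_iff divide_inverse)

text \<open>The equation z G' = q - 1, with the value at 0 filled in by q'(0) = -i eps. The explicit
  bound on \<open>\<epsilon>\<close> leaves room for the numerical estimates below.\<close>

locale spiral_primitive =
  fixes \<epsilon> :: real and G :: "complex \<Rightarrow> complex"
  assumes eps_pos: "0 < \<epsilon>" and eps_le: "\<epsilon> \<le> 1 / 100000"
    and G_0: "G 0 = 0"
    and G_deriv: "\<And>z. z \<in> unit_disc \<Longrightarrow>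
      (G has_field_derivative
        (if z = 0 then - (\<i> * of_real \<epsilon>) else (spiral_power \<epsilon> z - 1) / z)) (at z)"
begin

abbreviation q :: "complex \<Rightarrow> complex" where
  "q \<equiv> spiral_power \<epsilon>"

text \<open>The real part is -eps times the argument of 1 - z, which is below pi/2 in modulus. This
  keeps the modulus of \<open>q\<close> near 1.\<close>

lemma Re_exponent_le:
  assumes "z \<in> unit_disc"
  shows "\<bar>Re (\<i> * of_real \<epsilon> * Ln (1 - z))\<bar> \<le> 1 / 50000"
proof -
  have "\<bar>Im (Ln (1 - z))\<bar> \<le> 2"
    using Re_Ln_pos_lt_imp[OF Re_one_minus_pos[OF assms]] pi_less_4 by linarith
  then have "\<epsilon> * \<bar>Im (Ln (1 - z))\<bar> \<le> 1 / 100000 * 2"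
    using eps_pos eps_le by (intro mult_mono) auto
  then show ?thesis using eps_pos by (simp add: abs_mult)
qed

lemma norm_q:
  assumes "z \<in> unit_disc"
  shows "norm (q z) \<le> 11 / 10" "9 / 10 \<le> norm (q z)"
proof -
  define r where "r = Re (\<i> * of_real \<epsilon> * Ln (1 - z))"
  have r: "\<bar>r\<bar> \<le> 1 / 50000" unfolding r_def by (rule Re_exponent_le[OF assms])
  have n: "norm (q z) = exp r" by (simp add: spiral_power_def r_def)
  have "exp r \<le> exp (1 / 50000)" using r by simp
  also have "\<dots> \<le> 1 + 2 * (1 / 50000)" by (rule real_exp_bound_lemma) auto
  finally show "norm (q z) \<le> 11 / 10" unfolding n by simp
  show "9 / 10 \<le> norm (q z)" unfolding n using exp_ge_add_one_self[of r] r by linarith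
qed

text \<open>This makes the slow rotation of \<open>q\<close> precise: \<open>exp\<close> has
  Lipschitz constant below 2 where the exponents lie.\<close>

lemma norm_q_diff_le:
  assumes "z \<in> unit_disc" "w \<in> unit_disc"
  shows "norm (q z - q w) \<le> 2 * \<epsilon> * norm (Ln (1 - z) - Ln (1 - w))"
proof -
  have "norm (q z - q w) \<le>
      exp (1 / 50000) * norm (\<i> * of_real \<epsilon> * Ln (1 - z) - \<i> * of_real \<epsilon> * Ln (1 - w))"
    unfolding spiral_power_def
    by (rule norm_exp_diff_le) (use Re_exponent_le assms in \<open>force+\<close>)
  also have "\<dots> \<le> 2 * norm (\<i> * of_real \<epsilon> * Ln (1 - z) - \<i> * of_real \<epsilon> * Ln (1 - w))"
    using real_exp_bound_lemma[of "1 / 50000"] by (intro mult_right_mono) auto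
  also have "\<i> * of_real \<epsilon> * Ln (1 - z) - \<i> * of_real \<epsilon> * Ln (1 - w)
      = \<i> * of_real \<epsilon> * (Ln (1 - z) - Ln (1 - w))" by (simp add: algebra_simps)
  finally show ?thesis using eps_pos by (simp add: norm_mult)
qed

text \<open>Compare z with 0, where \<open>q\<close> is 1. The factor \<open>norm z\<close> cancels
  the denominator of (q - 1) / z; away from 1 the bound shows that \<open>q z\<close> is close to
  1.\<close>

lemma norm_q_minus_one_le:
  assumes "z \<in> unit_disc"
  shows "norm (1 - z) * norm (q z - 1) \<le> 8 * \<epsilon> * norm z"
proof -
  have "norm (q z - 1) \<le> 2 * \<epsilon> * norm (Ln (1 - z))"
    using norm_q_diff_le[OF assms, of 0] by simp
  then have "norm (1 - z) * norm (q z - 1) \<le> norm (1 - z) * (2 * \<epsilon> * norm (Ln (1 - z)))"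
    by (rule mult_left_mono) auto
  also have "\<dots> = 2 * \<epsilon> * (norm (1 - z) * norm (Ln (1 - z)))" by simp
  also have "norm (1 - z) * norm (Ln (1 - z)) \<le> 4 * norm (1 - (1 - z))"
    using assms norm_triangle_ineq4[of 1 z]
    by (intro norm_Ln_le Re_one_minus_pos) auto
  finally show ?thesis using eps_pos by simp
qed

text \<open>
  The derivative of G is unbounded near 1 relative to eps; adding (1 - z)(q - 1) cancels the
  part q - 1 of (q - 1) / z and leaves a derivative of size O(eps).
\<close>

lemma G_corrected_Lipschitz:
  assumes "z \<in> unit_disc" "w \<in> unit_disc"
  shows "norm ((G z + (1 - z) * (q z - 1)) - (G w + (1 - w) * (q w - 1))) \<le> 10 * \<epsilon> * norm (z - w)"
proof (rule field_differentiable_bound[where S = unit_disc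
      and f' = "\<lambda>z. (if z = 0 then - (\<i> * of_real \<epsilon>) else (1 - z) * (q z - 1) / z) - \<i> * of_real \<epsilon> * q z"])
  fix z assume z: "z \<in> unit_disc"
  have "1 - z \<noteq> 0" using Re_one_minus_pos[OF z] by auto
  then show "((\<lambda>z. G z + (1 - z) * (q z - 1)) has_field_derivative
      (if z = 0 then - (\<i> * of_real \<epsilon>) else (1 - z) * (q z - 1) / z) - \<i> * of_real \<epsilon> * q z)
      (at z within unit_disc)"
    by (intro DERIV_subset[OF DERIV_cong[OF DERIV_add[OF G_deriv[OF z] DERIV_mult[OF
              DERIV_diff[OF DERIV_const DERIV_ident]
              DERIV_diff[OF has_field_derivative_spiral_power[OF z] DERIV_const]]]]])
       (auto simp: divide_simps, auto simp: algebra_simps)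
  have "norm (if z = 0 then - (\<i> * of_real \<epsilon>) else (1 - z) * (q z - 1) / z) \<le> 8 * \<epsilon>"
    using norm_q_minus_one_le[OF z] eps_pos by (auto simp: norm_mult norm_divide divide_le_eq)
  moreover have "norm (\<i> * of_real \<epsilon> * q z) \<le> 2 * \<epsilon>"
    using norm_q(1)[OF z] eps_pos by (simp add: norm_mult)
  ultimately show "norm ((if z = 0 then - (\<i> * of_real \<epsilon>) else (1 - z) * (q z - 1) / z)
      - \<i> * of_real \<epsilon> * q z) \<le> 10 * \<epsilon>"
    by (intro order_trans[OF norm_triangle_ineq4]) linarith
qed (use assms in auto)

text \<open>Removing the correction from the Lipschitz bound leaves (1 - w)(q z - q w). As w is the
  point nearer to 1, the weight 1 - w absorbs the difference of logarithms.\<close>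

lemma G_diff_approx:
  assumes "z \<in> unit_disc" "w \<in> unit_disc" "norm (1 - w) \<le> norm (1 - z)"
  shows "norm (G z - G w - (q z - 1) * (z - w)) \<le> 1 / 1000 * norm (z - w)"
proof -
  have "norm (1 - w) * norm (q z - q w)
      \<le> norm (1 - w) * (2 * \<epsilon> * norm (Ln (1 - z) - Ln (1 - w)))"
    using norm_q_diff_le[OF assms(1,2)] by (rule mult_left_mono) auto
  also have "\<dots> = 2 * \<epsilon> * (norm (1 - w) * norm (Ln (1 - z) - Ln (1 - w)))" by simp
  also have "\<dots> \<le> 2 * \<epsilon> * (2 * norm ((1 - z) - (1 - w)))"
    using assms eps_pos by (intro mult_left_mono norm_Ln_diff_le Re_one_minus_pos) auto
  finally have 1: "norm ((1 - w) * (q z - q w)) \<le> 4 * \<epsilon> * norm (z - w)"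
    by (simp add: norm_mult norm_minus_commute)
  have "G z - G w - (q z - 1) * (z - w)
      = ((G z + (1 - z) * (q z - 1)) - (G w + (1 - w) * (q w - 1))) - (1 - w) * (q z - q w)"
    by (simp add: algebra_simps)
  then have "norm (G z - G w - (q z - 1) * (z - w)) \<le> 10 * \<epsilon> * norm (z - w) + 4 * \<epsilon> * norm (z - w)"
    using order_trans[OF norm_triangle_ineq4 add_mono[OF G_corrected_Lipschitz[OF assms(1,2)] 1]]
    by (simp only:)
  also have "\<dots> = (14 * \<epsilon>) * norm (z - w)" by (simp add: algebra_simps)
  also have "\<dots> \<le> 1 / 1000 * norm (z - w)"
    using eps_le by (intro mult_right_mono) auto
  finally show ?thesis .
qed

text \<open>Since \<open>exp\<close> contracts distances on the left half-plane and q - 1 is at most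
  3 in modulus, the chord estimate gives 3 + 1/1000. By symmetry \<open>exp a\<close> may be taken
  as the point farther from 1.\<close>

lemma norm_G_exp_diff_le:
  assumes "Re a < 0" "Re b < 0"
  shows "norm (G (exp a) - G (exp b)) \<le> 4 * norm (a - b)"
  using assms
proof (induction "norm (1 - exp b)" "norm (1 - exp a)" arbitrary: a b rule: linorder_wlog)
  case (le a b)
  define z w where "z = exp a" and "w = exp b"
  have zw: "z \<in> unit_disc" "w \<in> unit_disc" using le by (auto simp: z_def w_def)
  have le_diff: "norm (z - w) \<le> norm (a - b)"
    using norm_exp_diff_le[of a 0 b] le by (simp add: z_def w_def)
  have "norm (q z - 1) \<le> 3" using norm_triangle_ineq4[of "q z" 1] norm_q(1)[OF zw(1)] by simp
  then have "norm ((q z - 1) * (z - w)) \<le> 3 * norm (a - b)"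
    unfolding norm_mult using le_diff by (intro mult_mono) auto
  moreover have "norm (G z - G w - (q z - 1) * (z - w)) \<le> 1 / 1000 * norm (z - w)"
    using zw le by (intro G_diff_approx) (auto simp: z_def w_def)
  ultimately show ?case
    using le_diff norm_triangle_sub[of "G z - G w" "(q z - 1) * (z - w)"]
    unfolding z_def w_def using norm_ge_zero[of "a - b"] by linarith
next
  case (sym a b)
  then show ?case by (simp add: norm_minus_commute)
qed

text \<open>If z = exp a is near 1 and a, b are close, then z - w is nearly a - b and the sum is
  nearly q z (z - w). Otherwise the increment of G is small against a - b: either z and w are both
  near 1 while a and b are not close (say, they differ by about 2 pi i), or z is away from 1 and
  \<open>q z\<close> is near 1.\<close>

lemma norm_id_plus_G_exp_diff_ge:
  assumes "Re a < 0" "Re b < 0"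
  shows "norm (a - b) / 4 \<le> norm (a - b + (G (exp a) - G (exp b)))"
  using assms
proof (induction "norm (1 - exp b)" "norm (1 - exp a)" arbitrary: a b rule: linorder_wlog)
  case (le a b)
  define z w d where "z = exp a" and "w = exp b" and "d = norm (a - b)"
  have zw: "z \<in> unit_disc" "w \<in> unit_disc" using le by (auto simp: z_def w_def)
  have le_diff: "norm (z - w) \<le> d"
    using norm_exp_diff_le[of a 0 b] le by (simp add: z_def w_def d_def)
  have d0: "0 \<le> d" by (simp add: d_def)
  have approx: "norm (G z - G w - (q z - 1) * (z - w)) \<le> 1 / 1000 * norm (z - w)"
    using zw le by (intro G_diff_approx) (auto simp: z_def w_def)
  have "d / 4 \<le> norm (a - b + (G z - G w))"
  proof (cases "norm (1 - z) < 1 / 100 \<and> d < 1 / 4")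
    case True
    \<comment> \<open>The derivative exp s - 1 is small along the segment: exp s is within 1/4 of z,
      and z is within 1/100 of 1.\<close>
    have "norm ((exp a - a) - (exp b - b)) \<le> 26 / 100 * norm (a - b)"
    proof (rule field_differentiable_bound[where S = "closed_segment a b" and f' = "\<lambda>s. exp s - 1"])
      fix s assume s: "s \<in> closed_segment a b"
      have "convex {s. Re s < 0}" by (rule convex_halfspace_Re_lt)
      then have "closed_segment a b \<subseteq> {s. Re s < 0}"
        using le by (intro closed_segment_subset) auto
      then have "Re s \<le> 0" using s by auto
      then have "norm (exp s - z) \<le> norm (s - a)"
        using norm_exp_diff_le[of s 0 a] le by (simp add: z_def)
      also have "\<dots> \<le> d" unfolding d_def using s by (metis segment_bound(1) norm_minus_commute)
      finally have "norm (exp s - z) \<le> 25 / 100" using True by simp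
      moreover have "norm (z - 1) \<le> 1 / 100" using True by (simp add: norm_minus_commute)
      ultimately show "norm (exp s - 1) \<le> 26 / 100"
        using norm_triangle_ineq[of "exp s - z" "z - 1"] by simp
    qed (auto intro!: derivative_eq_intros)
    then have dev: "norm (z - w - (a - b)) \<le> 26 / 100 * d"
      by (simp add: z_def w_def d_def algebra_simps)
    have "74 / 100 * d \<le> norm (z - w)"
      using dev norm_triangle_ineq3[of "z - w" "a - b"] unfolding d_def by linarith
    \<comment> \<open>The main term is at least 0.666 d and the errors total at most 0.261 d,
      leaving more than d / 4.\<close>
    then have "9 / 10 * (74 / 100 * d) \<le> norm (q z * (z - w))"
      unfolding norm_mult using norm_q(2)[OF zw(1)] d0 by (intro mult_mono) auto
    moreover have "a - b + (G z - G w)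
        = q z * (z - w) + ((G z - G w - (q z - 1) * (z - w)) - (z - w - (a - b)))"
      by (simp add: algebra_simps)
    moreover have "norm ((G z - G w - (q z - 1) * (z - w)) - (z - w - (a - b))) \<le> 1 / 1000 * d + 26 / 100 * d"
      using norm_triangle_ineq4[of "G z - G w - (q z - 1) * (z - w)" "z - w - (a - b)"]
        approx dev le_diff by linarith
    ultimately show ?thesis
      using norm_diff_ineq[of "q z * (z - w)"
          "(G z - G w - (q z - 1) * (z - w)) - (z - w - (a - b))"] d0 by (simp only:)
  next
    case False
    have "norm ((q z - 1) * (z - w)) \<le> 24 / 100 * d"
    proof (cases "norm (1 - z) < 1 / 100")
      case True
      have "norm (z - w) \<le> norm (1 - z) + norm (1 - w)"
        using norm_triangle_ineq4[of "1 - w" "1 - z"] by simp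
      then have "norm (z - w) \<le> 2 / 100" using True le unfolding z_def w_def by linarith
      moreover have "norm (q z - 1) \<le> 3"
        using norm_triangle_ineq4[of "q z" 1] norm_q(1)[OF zw(1)] by simp
      ultimately have "norm (q z - 1) * norm (z - w) \<le> 3 * (2 / 100)"
        by (intro mult_mono) auto
      \<comment> \<open>Here d is at least 1/4, so 3 * 2/100 = 24/100 * 1/4 is at most 24/100 *
        d.\<close>
      then show ?thesis using True False by (simp add: norm_mult)
    next
      case far: False
      have "1 / 100 * norm (q z - 1) \<le> norm (1 - z) * norm (q z - 1)"
        using far by (intro mult_right_mono) auto
      also have "\<dots> \<le> 8 * \<epsilon> * norm z" by (rule norm_q_minus_one_le[OF zw(1)])
      also have "\<dots> \<le> 8 * (1 / 100000) * 1"
        using eps_pos eps_le zw by (intro mult_mono) auto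
      finally have "norm (q z - 1) \<le> 24 / 100" by simp
      then show ?thesis unfolding norm_mult using le_diff by (intro mult_mono) auto
    qed
    then have "norm (G z - G w) \<le> 24 / 100 * d + 1 / 1000 * d"
      using approx le_diff norm_triangle_sub[of "G z - G w" "(q z - 1) * (z - w)"] by linarith
    then show ?thesis
      using norm_diff_ineq[of "a - b" "G z - G w"] d0 unfolding d_def by linarith
  qed
  then show ?case by (simp add: d_def z_def w_def)
next
  case (sym a b)
  have "norm (a - b + (G (exp a) - G (exp b))) = norm (b - a + (G (exp b) - G (exp a)))"
    using norm_minus_cancel[of "a - b + (G (exp a) - G (exp b))"] by (simp add: algebra_simps)
  with sym show ?case by (simp add: norm_minus_commute)
qed

lemma G_holomorphic: "G holomorphic_on unit_disc"
  using G_deriv unfolding holomorphic_on_open[OF open_ball] by blast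

end

text \<open>The quotient (q - 1) / z has a removable singularity at 0, hence a primitive on the
  convex disc, normalised by subtracting its value at 0.\<close>

lemma spiral_primitive_exists:
  assumes "0 < \<epsilon>" "\<epsilon> \<le> 1 / 100000"
  obtains G where "spiral_primitive \<epsilon> G"
proof -
  let ?q = "spiral_power \<epsilon>"
  let ?h = "\<lambda>z. if z = 0 then deriv ?q 0 else (?q z - ?q 0) / (z - 0)"
  have "?q holomorphic_on unit_disc"
    using has_field_derivative_spiral_power unfolding holomorphic_on_open[OF open_ball] by blast
  then have "?h holomorphic_on unit_disc" by (rule pole_lemma_open) auto
  then obtain g where g: "\<And>z. z \<in> unit_disc \<Longrightarrow> (g has_field_derivative ?h z) (at z within unit_disc)"
    using holomorphic_convex_primitive'[of unit_disc ?h] by auto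
  have d: "deriv ?q 0 = - (\<i> * of_real \<epsilon>)"
    using DERIV_imp_deriv[OF has_field_derivative_spiral_power[of 0 \<epsilon>]] by simp
  have "spiral_primitive \<epsilon> (\<lambda>z. g z - g 0)"
  proof
    fix z assume z: "z \<in> unit_disc"
    then have "(g has_field_derivative ?h z) (at z)"
      using g[OF z] at_within_open[of z unit_disc] by simp
    then show "((\<lambda>z. g z - g 0) has_field_derivative
        (if z = 0 then - (\<i> * of_real \<epsilon>) else (?q z - 1) / z)) (at z)"
      by (auto intro!: derivative_eq_intros simp: d)
  qed (use assms in auto)
  then show ?thesis by (rule that)
qed

section \<open>Univalence of K_c for functions of the form z exp(g(z))\<close>

lemma deriv_times_exp_0:
  assumes "g holomorphic_on unit_disc" "g 0 = 0"
  shows "deriv (\<lambda>z. z * exp (g z)) 0 = 1"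
proof -
  have "(g has_field_derivative deriv g 0) (at 0)"
    using assms(1) by (rule holomorphic_derivI) auto
  then show ?thesis
    by (intro DERIV_imp_deriv) (auto intro!: derivative_eq_intros simp: assms)
qed

text \<open>Any competitor k has exp k = exp g on the disc, so k' = g', and k - g is constant with
  value 0 at the origin. Off the disc the definition prescribes 0, so the description is
  unique.\<close>

lemma Log_quot_times_exp:
  assumes "g holomorphic_on unit_disc" "g 0 = 0"
  shows "Log_quot (\<lambda>z. z * exp (g z)) = (\<lambda>z. if z \<in> unit_disc then g z else 0)"
  unfolding Log_quot_def
proof (rule the_equality)
  have quot: "quot_z (\<lambda>z. z * exp (g z)) z = exp (g z)" for z
    using assms deriv_times_exp_0[OF assms] by (simp add: quot_z_def)
  have "(\<lambda>z. if z \<in> unit_disc then g z else 0) holomorphic_on unit_disc"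
    using assms(1) by (rule holomorphic_transform) auto
  then show "(\<lambda>z. if z \<in> unit_disc then g z else 0) holomorphic_on unit_disc \<and>
      (if 0 \<in> unit_disc then g 0 else 0) = 0 \<and>
      (\<forall>z\<in>unit_disc. exp (if z \<in> unit_disc then g z else 0) = quot_z (\<lambda>z. z * exp (g z)) z) \<and>
      (\<forall>z. z \<notin> unit_disc \<longrightarrow> (if z \<in> unit_disc then g z else 0) = 0)"
    using assms quot by auto
  fix k assume k: "k holomorphic_on unit_disc \<and> k 0 = 0 \<and>
      (\<forall>z\<in>unit_disc. exp (k z) = quot_z (\<lambda>z. z * exp (g z)) z) \<and> (\<forall>z. z \<notin> unit_disc \<longrightarrow> k z = 0)"
  have exp_eq: "exp (k z) = exp (g z)" if "z \<in> unit_disc" for z using k that quot by auto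
  have "((\<lambda>z. k z - g z) has_field_derivative 0) (at z within unit_disc)" if z: "z \<in> unit_disc" for z
  proof -
    have dk: "(k has_field_derivative deriv k z) (at z)"
      using k z by (intro holomorphic_derivI[of k unit_disc]) auto
    have dg: "(g has_field_derivative deriv g z) (at z)"
      using assms z by (intro holomorphic_derivI[of g unit_disc]) auto
    have "((\<lambda>z. exp (k z)) has_field_derivative exp (k z) * deriv k z) (at z)"
      using dk by (auto intro!: derivative_eq_intros)
    then have "((\<lambda>z. exp (g z)) has_field_derivative exp (k z) * deriv k z) (at z)"
      by (rule has_field_derivative_transform_within_open[of _ _ _ unit_disc]) (use z exp_eq in auto)
    moreover have "((\<lambda>z. exp (g z)) has_field_derivative exp (g z) * deriv g z) (at z)"
      using dg by (auto intro!: derivative_eq_intros)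
    ultimately have "exp (k z) * deriv k z = exp (g z) * deriv g z" by (rule DERIV_unique)
    then have "deriv k z = deriv g z" using exp_eq[OF z] by simp
    then show ?thesis
      using DERIV_subset[OF DERIV_diff[OF dk dg], of unit_disc] by simp
  qed
  then obtain c where c: "\<And>z. z \<in> unit_disc \<Longrightarrow> k z - g z = c"
    using has_field_derivative_zero_constant[of unit_disc "\<lambda>z. k z - g z"] by auto
  have "c = 0" using c[of 0] k assms by simp
  then show "k = (\<lambda>z. if z \<in> unit_disc then g z else 0)" using c k by fastforce
qed

lemma U_set_times_exp:
  assumes "g holomorphic_on unit_disc" "g 0 = 0"
  shows "c \<in> U_set (\<lambda>z. z * exp (g z)) \<longleftrightarrow> inj_on (\<lambda>z. z * exp (c * g z)) unit_disc"
  unfolding U_set_def mem_Collect_eq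
  by (rule inj_on_cong) (simp add: K_op_def Log_quot_times_exp[OF assms])

text \<open>Pass to logarithms. The condition ranges over all of the left half-plane, not a strip,
  because equal images determine logarithms only up to multiples of 2 pi i.\<close>

lemma inj_on_times_exp:
  fixes g :: "complex \<Rightarrow> complex"
  assumes "\<And>a b. Re a < 0 \<Longrightarrow> Re b < 0 \<Longrightarrow> a \<noteq> b \<Longrightarrow> a - b + c * (g (exp a) - g (exp b)) \<noteq> 0"
  shows "inj_on (\<lambda>z. z * exp (c * g z)) unit_disc"
proof (rule inj_onI)
  fix z w assume zw: "z \<in> unit_disc" "w \<in> unit_disc"
    and eq: "z * exp (c * g z) = w * exp (c * g w)"
  show "z = w"
  proof (cases "z = 0 \<or> w = 0")
    case True
    then show ?thesis using eq by auto
  next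
    case False
    then have "exp (Ln z + c * g z) = exp (Ln w + c * g w)" using eq by (simp add: exp_add)
    then obtain n :: int where n: "Ln z + c * g z = Ln w + c * g w + (of_int (2 * n) * pi) * \<i>"
      unfolding exp_eq by blast
    \<comment> \<open>The period is absorbed into \<open>b\<close>, which remains a logarithm of
      \<open>w\<close>.\<close>
    define a b where "a = Ln z" and "b = Ln w + (of_int (2 * n) * pi) * \<i>"
    have "exp b = exp (Ln w)" unfolding exp_eq b_def by blast
    then have ab: "exp a = z" "exp b = w" using False by (simp_all add: a_def)
    have "a - b + c * (g (exp a) - g (exp b)) = 0"
      using n unfolding ab by (simp add: a_def b_def algebra_simps)
    moreover have "Re a < 0" "Re b < 0" using False zw by (simp_all add: a_def b_def)
    ultimately have "a = b" using assms by blast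
    then show ?thesis using ab by simp
  qed
qed

section \<open>Parameters c near 0, near 1 and on the line Re c = 1/2\<close>

context spiral_primitive
begin

lemma inj_near_0:
  assumes "norm c < 1 / 4"
  shows "inj_on (\<lambda>z. z * exp (c * G z)) unit_disc"
proof (rule inj_on_times_exp)
  fix a b :: complex assume ab: "Re a < 0" "Re b < 0" "a \<noteq> b"
  have "norm (c * (G (exp a) - G (exp b))) \<le> norm c * (4 * norm (a - b))"
    unfolding norm_mult using norm_G_exp_diff_le[OF ab(1,2)] by (rule mult_left_mono) auto
  also have "\<dots> < 1 / 4 * (4 * norm (a - b))"
    using assms ab by (intro mult_strict_right_mono) auto
  finally have "norm (c * (G (exp a) - G (exp b))) < norm (a - b)" by simp
  then show "a - b + c * (G (exp a) - G (exp b)) \<noteq> 0"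
    using norm_diff_ineq[of "a - b" "c * (G (exp a) - G (exp b))"] by auto
qed

text \<open>A perturbation of the case c = 1: the radius 1/16 times the Lipschitz constant 4 equals
  the expansion factor 1/4.\<close>

lemma inj_near_1:
  assumes "norm (c - 1) < 1 / 16"
  shows "inj_on (\<lambda>z. z * exp (c * G z)) unit_disc"
proof (rule inj_on_times_exp)
  fix a b :: complex assume ab: "Re a < 0" "Re b < 0" "a \<noteq> b"
  have "norm ((c - 1) * (G (exp a) - G (exp b))) \<le> norm (c - 1) * (4 * norm (a - b))"
    unfolding norm_mult using norm_G_exp_diff_le[OF ab(1,2)] by (rule mult_left_mono) auto
  also have "\<dots> < 1 / 16 * (4 * norm (a - b))"
    using assms ab by (intro mult_strict_right_mono) auto
  also have "\<dots> \<le> norm (a - b + (G (exp a) - G (exp b)))"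
    using norm_id_plus_G_exp_diff_ge[OF ab(1,2)] by simp
  finally have "0 < norm (a - b + (G (exp a) - G (exp b)) + (c - 1) * (G (exp a) - G (exp b)))"
    using norm_diff_ineq[of "a - b + (G (exp a) - G (exp b))" "(c - 1) * (G (exp a) - G (exp b))"]
    by linarith
  then show "a - b + c * (G (exp a) - G (exp b)) \<noteq> 0"
    by (auto simp: algebra_simps)
qed

text \<open>On this line c and c - 1 have equal modulus, so 1 - 1/c lies on the unit circle and is a
  value of \<open>q\<close> on the radius; there the derivative vanishes.\<close>

lemma not_inj_on_critical_line:
  assumes "Re c = 1 / 2"
  shows "\<not> inj_on (\<lambda>z. z * exp (c * G z)) unit_disc"
proof
  assume inj: "inj_on (\<lambda>z. z * exp (c * G z)) unit_disc"
  have c0: "c \<noteq> 0" using assms by auto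
  have "(norm (c - 1))\<^sup>2 = (norm c)\<^sup>2"
    unfolding cmod_power2 using assms by (simp add: power2_eq_square algebra_simps)
  then have "norm (c - 1) = norm c" by simp
  moreover have "1 - 1 / c = (c - 1) / c" using c0 by (simp add: field_simps)
  ultimately have "norm (1 - 1 / c) = 1" using c0 by (simp add: norm_divide)
  then have arg: "exp (\<i> * Arg (1 - 1 / c)) = 1 - 1 / c"
    using complex_norm_eq_1_exp_eq by blast
  \<comment> \<open>Subtracting 2 pi makes the angle negative, so that exp(theta / eps) lies in (0,
    1).\<close>
  define \<theta> where "\<theta> = Arg (1 - 1 / c) - 2 * pi"
  have "exp (\<i> * \<theta>) = exp (\<i> * Arg (1 - 1 / c))"
    unfolding \<theta>_def exp_eq by (rule exI[of _ "-1"]) (simp add: algebra_simps)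
  with arg have \<theta>: "exp (\<i> * \<theta>) = 1 - 1 / c" by (rule trans[rotated])
  have "\<theta> < 0" using Arg_bounded[of "1 - 1 / c"] pi_gt_zero unfolding \<theta>_def by linarith
  \<comment> \<open>The solution of (1 - z)^(i eps) = exp(i theta) on the real radius.\<close>
  define z :: complex where "z = of_real (1 - exp (\<theta> / \<epsilon>))"
  have "\<theta> / \<epsilon> < 0" using \<open>\<theta> < 0\<close> eps_pos by (simp add: divide_neg_pos)
  then have e1: "exp (\<theta> / \<epsilon>) < 1" by simp
  have z: "z \<in> unit_disc" "z \<noteq> 0" using e1 by (auto simp: z_def norm_of_real simp del: of_real_diff)
  have "1 - z = of_real (exp (\<theta> / \<epsilon>))" by (simp add: z_def)
  then have "1 - z = exp (of_real (\<theta> / \<epsilon>))" by (rule trans[OF _ exp_of_real[symmetric]])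
  then have "Ln (1 - z) = of_real (\<theta> / \<epsilon>)" using pi_gt_zero by simp
  then have "q z = 1 - 1 / c"
    using \<theta> eps_pos by (simp add: spiral_power_def)
  then have G': "(G has_field_derivative - 1 / (c * z)) (at z)"
    using G_deriv[OF z(1)] z(2) by simp
  \<comment> \<open>The product rule gives exp(c G) (1 + c z G'), and c z G' = -1 here.\<close>
  have "((\<lambda>z. z * exp (c * G z)) has_field_derivative 0) (at z)"
    using G' by (auto intro!: derivative_eq_intros simp: c0 z(2))
  then have "deriv (\<lambda>z. z * exp (c * G z)) z = 0" by (rule DERIV_imp_deriv)
  moreover have "deriv (\<lambda>z. z * exp (c * G z)) z \<noteq> 0"
    using inj z G_holomorphic
    by (intro holomorphic_injective_imp_regular[of _ unit_disc]) (auto intro!: holomorphic_intros)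
  ultimately show False by simp
qed

end

theorem theorem1p4:
  shows "\<exists>f. f holomorphic_on unit_disc \<and> inj_on f unit_disc \<and> f 0 = 0 \<and> deriv f 0 = 1 \<and>
     (\<exists>A B. A \<in> components (interior (U_set f)) \<and> B \<in> components (interior (U_set f)) \<and> A \<noteq> B)"
proof -
  obtain G where "spiral_primitive (1 / 100000) G"
    by (rule spiral_primitive_exists[of "1 / 100000"]) auto
  then interpret spiral_primitive "1 / 100000" G .
  define f where "f = (\<lambda>z. z * exp (G z))"
  define V where "V = interior (U_set f)"
  have U: "c \<in> U_set f \<longleftrightarrow> inj_on (\<lambda>z. z * exp (c * G z)) unit_disc" for c
    unfolding f_def by (rule U_set_times_exp[OF G_holomorphic G_0])
  have "0 \<in> V" unfolding V_def
    by (rule interiorI[of "ball 0 (1 / 4)"]) (auto simp: U inj_near_0)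
  moreover have "1 \<in> V" unfolding V_def
    by (rule interiorI[of "ball 1 (1 / 16)"]) (auto simp: U inj_near_1 dist_norm norm_minus_commute)
  moreover have "connected_component_set V 0 \<noteq> connected_component_set V 1"
  proof
    assume eq: "connected_component_set V 0 = connected_component_set V 1"
    have "0 \<in> connected_component_set V 0" using \<open>0 \<in> V\<close> by simp
    moreover have "1 \<in> connected_component_set V 0" unfolding eq using \<open>1 \<in> V\<close> by simp
    \<comment> \<open>The inner product with 1 is the real part, so a connected set containing 0 and
      1 meets the line Re c = 1/2.\<close>
    ultimately obtain c where "c \<in> connected_component_set V 0" "c \<bullet> 1 = 1 / 2"
      using connected_ivt_component[OF connected_connected_component, of 0 V 0 1 1 "1 / 2"] by auto
    then have "c \<in> U_set f" "Re c = 1 / 2"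
      using connected_component_subset[of V 0] interior_subset[of "U_set f"] by (auto simp: V_def)
    then show False using U not_inj_on_critical_line by blast
  qed
  ultimately have comps: "\<exists>A B. A \<in> components V \<and> B \<in> components V \<and> A \<noteq> B"
    by (metis componentsI)
  have "f holomorphic_on unit_disc"
    unfolding f_def by (intro holomorphic_intros G_holomorphic)
  moreover have "inj_on f unit_disc" using inj_near_1[of 1] by (simp add: f_def)
  moreover have "f 0 = 0" by (simp add: f_def)
  moreover have "deriv f 0 = 1"
    unfolding f_def by (rule deriv_times_exp_0[OF G_holomorphic G_0])
  ultimately show ?thesis using comps unfolding V_def by blast
qed

end
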